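(* Let $H=\sum_{j=1}^m H_j$ be a Hamiltonian, with each $H_j$ Hermitian, to be simulated for time $t$, and let $\tau=\|H\|t$. Let $N_{\rm exp}$ denote the number of exponentials required to simulate the evolution $e^{-iHt}$ by a sequence of exponentials of the form $e^{-iH_jt'}$ such that the maximum error in the final state, as quantified by the trace distance, does not exceed $\epsilon$. Let $k$ be an arbitrary positive integer. When the permissible error is bounded by $\epsilon$, $N_{\rm exp}$ is bounded by $$N_{\rm exp}\le 2m\,5^{2k}\,(m\tau)^{1+1/2k}/\epsilon^{1/2k},$$ for $\epsilon\le 1\le 2m\,5^{k-1}\tau$.
   Context: $\|\cdot\|$ is the operator (spectral) norm. The trace distance of two density operators is $D(\rho,\sigma)=\frac12\mathrm{Tr}|\rho-\sigma|$. The error of a simulation $V$ (a product of exponentials $e^{-iH_jt'}$, with $j\in\{1,\dots,m\}$ and times $t'$ that may vary from factor to factor) is the maximum over initial states $|\psi\rangle$ of the trace distance between the state evolved by $V$ and the state evolved by $e^{-iHt}$. The bound on $N_{\rm exp}$ means that a sequence with at most that many exponentials suffices. Exponents such as $1+1/2k$ mean $1+\frac{1}{2k}$.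
   Formalization: The formal theorem additionally assumes ‖H_j‖ ≤ ‖H‖ for every j; without such a condition the bound fails, e.g. H_1 = LZ, H_2 = X − LZ with L large, t = π/2, k = 1, ε = 1/2. *)

theory Defs
  imports "HOL-Analysis.Analysis"
begin

(* Operators on an n-dimensional Hilbert space are matrices of type complex^'n^'n.  The library
   operations * and ^ on this type act entrywise; the matrix product is **. *)

definition adj :: "complex^'n^'n \<Rightarrow> complex^'n^'n" where
  "adj A = (\<chi> i j. cnj (A $ j $ i))"

definition hermitian :: "complex^'n^'n \<Rightarrow> bool" where
  "hermitian A \<longleftrightarrow> adj A = A"

definition op_norm :: "complex^'n^'n \<Rightarrow> real" where
  "op_norm A = onorm (\<lambda>x. A *v x)"

definition mat_pow :: "complex^'n^'n \<Rightarrow> nat \<Rightarrow> complex^'n^'n" where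
  "mat_pow A n = (((**) A) ^^ n) (mat 1)"

definition mat_exp :: "complex^'n^'n \<Rightarrow> complex^'n^'n" where
  "mat_exp A = (\<Sum>n. (1 / fact n) *\<^sub>R mat_pow A n)"

definition evol :: "complex^'n^'n \<Rightarrow> real \<Rightarrow> complex^'n^'n" where
  "evol H t = mat_exp (map_matrix (\<lambda>z. - \<i> * complex_of_real t * z) H)"

(* The pair (j, s) stands for the exponential of -i H_j s. *)
definition exp_product :: "(nat \<Rightarrow> complex^'n^'n) \<Rightarrow> (nat \<times> real) list \<Rightarrow> complex^'n^'n" where
  "exp_product Hs xs = foldr (\<lambda>(j, s) V. evol (Hs j) s ** V) xs (mat 1)"

definition cinner :: "complex^'n \<Rightarrow> complex^'n \<Rightarrow> complex" where
  "cinner x y = (\<Sum>i\<in>UNIV. cnj (x $ i) * y $ i)"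

(* The inner product below is real because A is Hermitian. *)
definition pos_semidef :: "complex^'n^'n \<Rightarrow> bool" where
  "pos_semidef A \<longleftrightarrow> hermitian A \<and> (\<forall>x. 0 \<le> Re (cinner x (A *v x)))"

definition mat_abs :: "complex^'n^'n \<Rightarrow> complex^'n^'n" where
  "mat_abs A = (THE P. pos_semidef P \<and> P ** P = adj A ** A)"

definition trace_distance :: "complex^'n^'n \<Rightarrow> complex^'n^'n \<Rightarrow> real" where
  "trace_distance \<rho> \<sigma> = Re (trace (mat_abs (\<rho> - \<sigma>))) / 2"

definition pure_state :: "complex^'n \<Rightarrow> complex^'n^'n" where
  "pure_state \<psi> = (\<chi> i j. \<psi> $ i * cnj (\<psi> $ j))"

definition sim_error :: "complex^'n^'n \<Rightarrow> complex^'n^'n \<Rightarrow> real" where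
  "sim_error V U =
     (SUP \<psi>\<in>{\<psi>. norm \<psi> = 1}. trace_distance (pure_state (V *v \<psi>)) (pure_state (U *v \<psi>)))"

end

theory Submission
  imports Defs "HOL-Computational_Algebra.Formal_Power_Series"
begin

text \<open>Suzuki's recursion builds from a palindromic product \<open>S\<close> with
  \<open>S(\<lambda>) = exp(\<lambda>A) + O(\<lambda>\<^sup>n)\<close>, \<open>n\<close> odd, the product \<open>S(p\<lambda>)\<^sup>2 S((1 - 4p)\<lambda>) S(p\<lambda>)\<^sup>2\<close>,
  where \<open>4p\<^sup>n + (1 - 4p)\<^sup>n = 0\<close> cancels the error term of degree \<open>n\<close> and the palindromic
  shape cancels that of degree \<open>n + 1\<close>.  Both cancellations are statements about formal power
  series with noncommuting coefficients.  Since \<open>|p|\<close> and \<open>|1 - 4p|\<close> are at most 1, the total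
  time after \<open>k - 1\<close> steps is at most \<open>m 5\<^bsup>k-1\<^esup>\<close>.  Hence, with \<open>x = m 5\<^bsup>k-1\<^esup> \<tau>/r\<close>, the
  coefficients of degree \<open>n\<close> of both series are at most \<open>x\<^sup>n/n!\<close> in norm, and one of the \<open>r\<close>
  time slices costs an error of at most \<open>2 x\<^bsup>2k+1\<^esup> e\<^sup>x\<close>.  All evolutions are unitary, so errors
  add up, and the trace distance of two pure states is at most the distance of the state vectors.\<close>

section \<open>Exponential series with noncommuting coefficients\<close>

notation fps_nth (infixl "$$" 75)

definition fps_Exp :: "'a::real_normed_algebra_1 \<Rightarrow> 'a fps" where
  "fps_Exp a = Abs_fps (\<lambda>n. a ^ n /\<^sub>R fact n)"

text \<open>The substitution of \<open>c X\<close> for X. On a product of exponentials it multiplies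
  every time by \<open>c\<close>.\<close>

definition fps_dilate :: "real \<Rightarrow> 'a::real_normed_algebra_1 fps \<Rightarrow> 'a fps" where
  "fps_dilate c f = Abs_fps (\<lambda>n. c ^ n *\<^sub>R fps_nth f n)"

lemma fps_Exp_nth [simp]: "fps_nth (fps_Exp a) n = a ^ n /\<^sub>R fact n"
  by (simp add: fps_Exp_def)

lemma fps_dilate_nth [simp]: "fps_nth (fps_dilate c f) n = c ^ n *\<^sub>R fps_nth f n"
  by (simp add: fps_dilate_def)

lemma fps_Exp_0 [simp]: "fps_Exp 0 = 1"
  by (rule fps_ext) (simp add: power_0_left)

lemma fps_dilate_1 [simp]: "fps_dilate c 1 = 1"
  by (rule fps_ext) (simp add: fps_one_def)

lemma fps_dilate_mult: "fps_dilate c (f * g) = fps_dilate c f * fps_dilate c g"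
proof (rule fps_ext)
  fix n
  have "c ^ n *\<^sub>R (fps_nth f i * fps_nth g (n - i)) =
      c ^ i *\<^sub>R fps_nth f i * c ^ (n - i) *\<^sub>R fps_nth g (n - i)" if "i \<le> n" for i
    using that by (simp flip: power_add)
  then show "fps_nth (fps_dilate c (f * g)) n = fps_nth (fps_dilate c f * fps_dilate c g) n"
    unfolding fps_mult_nth fps_dilate_nth scaleR_sum_right by (intro sum.cong refl) simp
qed

lemma fps_dilate_Exp: "fps_dilate c (fps_Exp a) = fps_Exp (c *\<^sub>R a)"
  by (rule fps_ext) simp

lemma fps_Exp_add_commuting:
  fixes a b :: "'a::{real_normed_algebra_1,banach}"
  assumes "a * b = b * a"
  shows "fps_Exp (a + b) = fps_Exp a * fps_Exp b"
  by (rule fps_ext)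
    (simp only: fps_mult_nth fps_Exp_nth exp_series_add_commuting[OF assms] atMost_atLeast0)

lemma fps_Exp_add_scaleR:
  fixes a :: "'a::{real_normed_algebra_1,banach}"
  shows "fps_Exp (c *\<^sub>R a) * fps_Exp (d *\<^sub>R a) = fps_Exp ((c + d) *\<^sub>R a)"
  by (simp add: fps_Exp_add_commuting scaleR_add_left)

text \<open>This is congruence modulo X^n, that is \<open>f = g + O(X^n)\<close>; the coefficient of
  degree \<open>n\<close> itself is left free.\<close>

definition fps_agree :: "nat \<Rightarrow> 'a::real_normed_algebra_1 fps \<Rightarrow> 'a fps \<Rightarrow> bool" where
  "fps_agree n f g \<longleftrightarrow> (\<forall>i<n. fps_nth f i = fps_nth g i)"

lemma fps_agree_mult:
  "fps_agree n f f' \<Longrightarrow> fps_agree n g g' \<Longrightarrow> fps_agree n (f * g) (f' * g')"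
  by (simp add: fps_agree_def fps_mult_nth)

lemma fps_agree_dilate: "fps_agree n f g \<Longrightarrow> fps_agree n (fps_dilate c f) (fps_dilate c g)"
  by (simp add: fps_agree_def)

lemma fps_agree_Suc:
  "fps_agree (Suc n) f g \<longleftrightarrow> fps_agree n f g \<and> fps_nth f n - fps_nth g n = 0"
  by (auto simp: fps_agree_def less_Suc_eq)

text \<open>In degree \<open>n\<close> the mixed terms involve only coefficients of smaller degree,
  which agree, and the two outer terms carry a constant coefficient 1. So leading errors add under
  multiplication.\<close>

lemma fps_agree_mult_nth_diff:
  fixes f g :: "'a::real_normed_algebra_1 fps"
  assumes "fps_agree n f f'" "fps_agree n g g'" "0 < n" "fps_nth f' 0 = 1" "fps_nth g' 0 = 1"
  shows "fps_nth (f * g) n - fps_nth (f' * g') n =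
    (fps_nth f n - fps_nth f' n) + (fps_nth g n - fps_nth g' n)"
proof -
  obtain k where k: "n = Suc k" using assms(3) by (cases n) auto
  have *: "fps_nth (p * q) n = p $$ 0 * q $$ n + (\<Sum>i=1..k. p $$ i * q $$ (n - i)) + p $$ n * q $$ 0"
    for p q :: "'a fps"
    by (simp add: fps_mult_nth k sum.atLeast_Suc_atMost)
  have "f $$ 0 = 1" "g $$ 0 = 1"
    using assms by (auto simp: fps_agree_def)
  moreover have "(\<Sum>i=1..k. f $$ i * g $$ (n - i)) = (\<Sum>i=1..k. f' $$ i * g' $$ (n - i))"
    using assms by (intro sum.cong) (auto simp: fps_agree_def k)
  ultimately show ?thesis
    unfolding * using assms by simp
qed

text \<open>Comparing coefficient \<open>n\<close> on both sides of \<open>f(-X) f(X) = 1 = e(-X) e(X)\<close> gives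
  \<open>((-1)^n + 1) (f_n - e_n) = 0\<close>.\<close>

lemma fps_agree_symmetric_even:
  fixes f :: "'a::{real_normed_algebra_1,banach} fps"
  assumes "fps_agree n f (fps_Exp a)" "even n" "0 < n" "fps_dilate (-1) f * f = 1"
  shows "fps_agree (Suc n) f (fps_Exp a)"
proof -
  let ?e = "fps_Exp a"
  let ?d = "f $$ n - ?e $$ n"
  have e: "fps_dilate (-1) ?e * ?e = 1"
    using fps_Exp_add_scaleR[of "-1" a 1] by (simp add: fps_dilate_Exp)
  have "0 = (fps_dilate (-1) f * f) $$ n - (fps_dilate (-1) ?e * ?e) $$ n"
    using assms(4) e by simp
  also have "\<dots> = (fps_dilate (-1) f $$ n - fps_dilate (-1) ?e $$ n) + ?d"
    using assms by (intro fps_agree_mult_nth_diff fps_agree_dilate) auto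
  also have "\<dots> = 2 *\<^sub>R ?d"
    using \<open>even n\<close> by (simp add: scaleR_2)
  finally show ?thesis
    using assms(1) by (simp add: fps_agree_Suc)
qed

text \<open>Dilation by \<open>c\<close> multiplies the leading error by \<open>c ^ n\<close>, and
  multiplication adds leading errors. The five factors have total time 1 and total error weight
  \<open>4 * p ^ n + (1 - 4 * p) ^ n\<close>.\<close>

lemma fps_agree_suzuki:
  fixes f :: "'a::{real_normed_algebra_1,banach} fps"
  assumes f: "fps_agree n f (fps_Exp a)" and n: "0 < n"
    and p: "4 * p ^ n + (1 - 4 * p) ^ n = 0"
  defines "g \<equiv> fps_dilate p f * (fps_dilate p f * (fps_dilate (1 - 4 * p) f *
    (fps_dilate p f * fps_dilate p f)))"
  shows "fps_agree (Suc n) g (fps_Exp a)"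
proof -
  let ?d = "f $$ n - fps_Exp a $$ n"
  \<comment> \<open>The invariant pairs the time \<open>r\<close> of the approximated exponential
    with the weight \<open>x\<close> of the leading error \<open>?d\<close>; a product adds
    both.\<close>
  have mult: "fps_agree n (u * v) (fps_Exp ((r + s) *\<^sub>R a)) \<and>
      (u * v) $$ n - fps_Exp ((r + s) *\<^sub>R a) $$ n = (x + y) *\<^sub>R ?d"
    if "fps_agree n u (fps_Exp (r *\<^sub>R a)) \<and> u $$ n - fps_Exp (r *\<^sub>R a) $$ n = x *\<^sub>R ?d"
      "fps_agree n v (fps_Exp (s *\<^sub>R a)) \<and> v $$ n - fps_Exp (s *\<^sub>R a) $$ n = y *\<^sub>R ?d"
    for u v r s x y
    unfolding fps_Exp_add_scaleR[symmetric]
    using that n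
    by (subst fps_agree_mult_nth_diff) (auto simp: fps_agree_mult scaleR_add_left)
  have dil: "fps_agree n (fps_dilate c f) (fps_Exp (c *\<^sub>R a)) \<and>
      fps_dilate c f $$ n - fps_Exp (c *\<^sub>R a) $$ n = c ^ n *\<^sub>R ?d" for c
    using fps_agree_dilate[OF f, of c] by (simp add: fps_dilate_Exp scaleR_diff_right)
  have "fps_agree n g (fps_Exp ((p + (p + (1 - 4 * p + (p + p)))) *\<^sub>R a)) \<and>
      g $$ n - fps_Exp ((p + (p + (1 - 4 * p + (p + p)))) *\<^sub>R a) $$ n =
      (p ^ n + (p ^ n + ((1 - 4 * p) ^ n + (p ^ n + p ^ n)))) *\<^sub>R ?d"
    unfolding g_def by (intro mult dil)
  moreover have "p + (p + (1 - 4 * p + (p + p))) = 1"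
    by simp
  moreover have "p ^ n + (p ^ n + ((1 - 4 * p) ^ n + (p ^ n + p ^ n))) = 0"
    using p by simp
  ultimately show ?thesis
    by (simp add: fps_agree_Suc)
qed

section \<open>Suzuki's product formula\<close>

text \<open>With \<open>q\<close> the n-th root of 4, take \<open>p = 1 / (4 - q)\<close>. Then
  \<open>1 - 4 * p = - (q * p)\<close>, and odd \<open>n\<close> gives the cancellation. Since
  \<open>3 \<le> n\<close>, \<open>q \<le> 2\<close>, which yields both bounds.\<close>

lemma suzuki_coefficient_exists:
  assumes "odd n" "3 \<le> n"
  obtains p :: real where "4 * p ^ n + (1 - 4 * p) ^ n = 0" "\<bar>p\<bar> \<le> 1" "\<bar>1 - 4 * p\<bar> \<le> 1"
proof -
  define q where "q = root n 4"
  have qn: "q ^ n = 4" and q0: "0 < q"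
    using assms by (auto simp: q_def)
  have q2: "q \<le> 2"
  proof (rule power_le_imp_le_base)
    have "(4::real) \<le> 2 ^ 3" by simp
    also have "\<dots> \<le> 2 ^ n" using assms by (intro power_increasing) auto
    finally show "q ^ Suc (n - 1) \<le> 2 ^ Suc (n - 1)" using qn assms by simp
  qed simp
  define p where "p = 1 / (4 - q)"
  have p4: "1 - 4 * p = - (q / (4 - q))"
    using q2 by (simp add: p_def field_simps)
  show thesis
  proof
    show "4 * p ^ n + (1 - 4 * p) ^ n = 0"
      unfolding p4 power_minus_odd[OF assms(1)] using qn by (simp add: p_def power_divide)
    show "\<bar>p\<bar> \<le> 1" "\<bar>1 - 4 * p\<bar> \<le> 1"
      unfolding p4 using q0 q2 by (auto simp: p_def field_simps)
  qed
qed

section \<open>Lists of timed generators and their series\<close>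

definition scale_times :: "real \<Rightarrow> ('j \<times> real) list \<Rightarrow> ('j \<times> real) list" where
  "scale_times c = map (\<lambda>(j, s). (j, c * s))"

text \<open>Absolute values are taken because Suzuki's middle factor runs backwards in time: its
  coefficient \<open>1 - 4 * p\<close> is negative.\<close>

definition total_time :: "('j \<times> real) list \<Rightarrow> real" where
  "total_time xs = (\<Sum>(j, s)\<leftarrow>xs. \<bar>s\<bar>)"

definition fps_product :: "('j \<Rightarrow> 'a::real_normed_algebra_1) \<Rightarrow> ('j \<times> real) list \<Rightarrow> 'a fps" where
  "fps_product a xs = (\<Prod>(j, s)\<leftarrow>xs. fps_Exp (s *\<^sub>R a j))"

lemma length_scale_times [simp]: "length (scale_times c xs) = length xs"
  by (simp add: scale_times_def)

lemma fst_set_scale_times [simp]: "fst ` set (scale_times c xs) = fst ` set xs"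
  by (force simp: scale_times_def image_iff)

lemma rev_scale_times: "rev (scale_times c xs) = scale_times c (rev xs)"
  by (simp add: scale_times_def rev_map)

lemma total_time_append [simp]: "total_time (xs @ ys) = total_time xs + total_time ys"
  by (simp add: total_time_def)

lemma total_time_nonneg: "0 \<le> total_time xs"
  unfolding total_time_def by (intro sum_list_nonneg) auto

lemma total_time_Cons [simp]: "total_time (x # xs) = \<bar>snd x\<bar> + total_time xs"
  by (simp add: total_time_def split_beta)

lemma total_time_Nil [simp]: "total_time [] = 0"
  by (simp add: total_time_def)

lemma total_time_scale_times [simp]: "total_time (scale_times c xs) = \<bar>c\<bar> * total_time xs"
  by (induction xs) (auto simp: scale_times_def abs_mult algebra_simps)

lemma fps_product_Nil [simp]: "fps_product a [] = 1"
  by (simp add: fps_product_def)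

lemma fps_product_Cons [simp]:
  "fps_product a (x # xs) = fps_Exp (snd x *\<^sub>R a (fst x)) * fps_product a xs"
  by (simp add: fps_product_def split_beta)

lemma fps_product_append: "fps_product a (xs @ ys) = fps_product a xs * fps_product a ys"
  by (simp add: fps_product_def)

lemma fps_product_scale_times: "fps_product a (scale_times c xs) = fps_dilate c (fps_product a xs)"
  by (induction xs) (auto simp: scale_times_def fps_dilate_mult fps_dilate_Exp)

lemma fps_product_nth_0 [simp]: "fps_product a xs $$ 0 = 1"
  by (induction xs) (simp_all add: fps_mult_nth)

lemma fps_product_nth_1: "fps_product a xs $$ 1 = (\<Sum>(j, s)\<leftarrow>xs. s *\<^sub>R a j)"
proof (induction xs)
  case Nil
  then show ?case by (simp add: fps_one_def)
next
  case (Cons x xs)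
  have "fps_product a (x # xs) $$ 1 = snd x *\<^sub>R a (fst x) + fps_product a xs $$ 1"
    by (simp add: fps_mult_nth_1)
  then show ?case
    using Cons by (simp add: split_beta)
qed

text \<open>The factors cancel from the middle outwards. For a palindromic list this is the symmetry
  \<open>f(-X) f(X) = 1\<close> required by \<open>fps_agree_symmetric_even\<close>.\<close>

lemma fps_product_rev:
  fixes a :: "'j \<Rightarrow> 'a::{real_normed_algebra_1,banach}"
  shows "fps_dilate (-1) (fps_product a (rev xs)) * fps_product a xs = 1"
proof (induction xs)
  case (Cons x xs)
  have "fps_Exp (-1 *\<^sub>R (snd x *\<^sub>R a (fst x))) * (fps_Exp (snd x *\<^sub>R a (fst x)) * fps_product a xs)
      = fps_product a xs"
    using fps_Exp_add_scaleR[of "-1" "snd x *\<^sub>R a (fst x)" 1] by (simp flip: mult.assoc)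
  then show ?case
    using Cons by (simp add: fps_product_append fps_dilate_mult fps_dilate_Exp mult.assoc)
qed simp

text \<open>This is Strang splitting. The half times add up to the correct linear coefficient, and
  the palindromic shape supplies degree 2.\<close>

lemma fps_product_Strang:
  fixes a :: "nat \<Rightarrow> 'a::{real_normed_algebra_1,banach}" and m :: nat
  defines "ys \<equiv> map (\<lambda>j. (j, 1 / 2 :: real)) [1..<Suc m]"
  shows "fps_agree 3 (fps_product a (ys @ rev ys)) (fps_Exp (\<Sum>j=1..m. a j))"
proof -
  have "(\<Sum>(j, s)\<leftarrow>ys. s *\<^sub>R a j) = (\<Sum>j\<in>{1..<Suc m}. (1 / 2) *\<^sub>R a j)"
    by (simp add: ys_def o_def interv_sum_list_conv_sum_set_nat del: upt_Suc)
  also have "\<dots> = (1 / 2) *\<^sub>R (\<Sum>j=1..m. a j)"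
    by (simp only: scaleR_sum_right atLeastLessThanSuc_atLeastAtMost)
  finally have half: "(\<Sum>(j, s)\<leftarrow>ys. s *\<^sub>R a j) = (1 / 2) *\<^sub>R (\<Sum>j=1..m. a j)" .
  have "(\<Sum>(j, s)\<leftarrow>rev ys. s *\<^sub>R a j) = (\<Sum>(j, s)\<leftarrow>ys. s *\<^sub>R a j)"
    by (simp only: rev_map[symmetric] sum_list.rev)
  then have "fps_product a (ys @ rev ys) $$ 1 =
      (1 / 2) *\<^sub>R (\<Sum>j=1..m. a j) + (1 / 2) *\<^sub>R (\<Sum>j=1..m. a j)"
    by (simp only: fps_product_nth_1 map_append sum_list_append half)
  also have "\<dots> = (\<Sum>j=1..m. a j)"
    by (simp flip: scaleR_add_left)
  finally have "fps_agree 2 (fps_product a (ys @ rev ys)) (fps_Exp (\<Sum>j=1..m. a j))"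
    by (simp add: fps_agree_def numeral_2_eq_2 less_Suc_eq)
  from fps_agree_symmetric_even[OF this] show ?thesis
    using fps_product_rev[of a "ys @ rev ys"] by simp
qed

text \<open>Here \<open>k\<close> counts recursion steps from the Strang splitting, so it is one
  less than the \<open>k\<close> of the final bound. The palindrome condition is part of the
  induction because each step uses it again.\<close>

lemma suzuki_sequence_exists:
  fixes a :: "nat \<Rightarrow> 'a::{real_normed_algebra_1,banach}"
  shows "\<exists>xs. fst ` set xs \<subseteq> {1..m} \<and> rev xs = xs \<and> length xs = 2 * m * 5 ^ k \<and>
    total_time xs \<le> real m * 5 ^ k \<and>
    fps_agree (2 * k + 3) (fps_product a xs) (fps_Exp (\<Sum>j=1..m. a j))"
proof (induction k)
  case 0
  define ys where "ys = map (\<lambda>j. (j, 1 / 2 :: real)) [1..<Suc m]"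
  have "total_time ys = real m / 2" "total_time (rev ys) = real m / 2"
    by (simp_all add: ys_def total_time_def o_def rev_map sum_list_triv del: upt_Suc)
  then show ?case
    using fps_product_Strang[of a m] unfolding ys_def[symmetric]
    by (intro exI[of _ "ys @ rev ys"]) (auto simp: ys_def simp del: upt_Suc)
next
  case (Suc k)
  then obtain xs where xs: "fst ` set xs \<subseteq> {1..m}" "rev xs = xs" "length xs = 2 * m * 5 ^ k"
    "total_time xs \<le> real m * 5 ^ k"
    "fps_agree (2 * k + 3) (fps_product a xs) (fps_Exp (\<Sum>j=1..m. a j))"
    by blast
  obtain p :: real where p: "4 * p ^ (2 * k + 3) + (1 - 4 * p) ^ (2 * k + 3) = 0"
    "\<bar>p\<bar> \<le> 1" "\<bar>1 - 4 * p\<bar> \<le> 1"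
    by (rule suzuki_coefficient_exists[of "2 * k + 3"]) auto
  let ?p = "scale_times p xs"
  define ys where "ys = ?p @ ?p @ scale_times (1 - 4 * p) xs @ ?p @ ?p"
  have sym: "rev ys = ys"
    by (simp add: ys_def rev_scale_times xs)
  have "fps_agree (Suc (2 * k + 3)) (fps_product a ys) (fps_Exp (\<Sum>j=1..m. a j))"
    using fps_agree_suzuki[OF xs(5) _ p(1)]
    by (simp add: ys_def fps_product_append fps_product_scale_times)
  \<comment> \<open>Suzuki's coefficients removed the odd degree \<open>2 * k + 3\<close>; symmetry
    now removes the even degree \<open>2 * k + 4\<close>.\<close>
  then have "fps_agree (Suc (Suc (2 * k + 3))) (fps_product a ys) (fps_Exp (\<Sum>j=1..m. a j))"
    by (rule fps_agree_symmetric_even) (use fps_product_rev[of a ys] sym in auto)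
  moreover have "total_time ys \<le> real m * 5 ^ Suc k"
  proof -
    \<comment> \<open>Each of the five dilated copies takes no more total time than the bound for
      \<open>xs\<close>.\<close>
    have "\<bar>c\<bar> * total_time xs \<le> real m * 5 ^ k" if "\<bar>c\<bar> \<le> 1" for c
      using that xs(4) total_time_nonneg[of xs] mult_mono[of "\<bar>c\<bar>" 1 "total_time xs" "real m * 5 ^ k"]
      by simp
    from this[OF p(2)] this[OF p(3)] show ?thesis
      by (simp add: ys_def)
  qed
  ultimately show ?case
    using sym xs by (intro exI[of _ ys]) (auto simp: ys_def image_Un)
qed


section \<open>Truncation error\<close>

text \<open>Coefficientwise domination by the scalar series \<open>exp(xX)\<close>. It is compatible
  with products because the majorants multiply to \<open>exp((x + y)X)\<close>.\<close>

definition fps_majorized :: "real \<Rightarrow> 'a::real_normed_algebra_1 fps \<Rightarrow> bool" where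
  "fps_majorized x f \<longleftrightarrow> (\<forall>n. norm (f $$ n) \<le> x ^ n / fact n)"

lemma fps_majorized_Exp: "norm a \<le> x \<Longrightarrow> fps_majorized x (fps_Exp a)"
  unfolding fps_majorized_def
  by (auto simp: divide_inverse mult.commute
      intro!: mult_left_mono order.trans[OF norm_power_ineq] power_mono)

lemma fps_majorized_mult:
  assumes "fps_majorized x f" "fps_majorized y g" "0 \<le> x"
  shows "fps_majorized (x + y) (f * g)"
  unfolding fps_majorized_def
proof
  fix n
  have "norm ((f * g) $$ n) \<le> (\<Sum>i=0..n. norm (f $$ i) * norm (g $$ (n - i)))"
    unfolding fps_mult_nth by (intro sum_norm_le norm_mult_ineq)
  also have "\<dots> \<le> (\<Sum>i=0..n. (x ^ i /\<^sub>R fact i) * (y ^ (n - i) /\<^sub>R fact (n - i)))"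
    using assms by (intro sum_mono mult_mono) (auto simp: fps_majorized_def divide_inverse_commute)
  also have "\<dots> = (x + y) ^ n / fact n"
    using exp_series_add_commuting[of x y n] by (simp add: mult.commute atMost_atLeast0 divide_inverse)
  finally show "norm ((f * g) $$ n) \<le> (x + y) ^ n / fact n" .
qed

lemma fps_majorized_mono:
  assumes "fps_majorized x f" "0 \<le> x" "x \<le> y"
  shows "fps_majorized y f"
  unfolding fps_majorized_def
proof
  fix n
  have "norm (f $$ n) \<le> x ^ n / fact n"
    using assms by (simp add: fps_majorized_def)
  also have "\<dots> \<le> y ^ n / fact n"
    using assms by (intro divide_right_mono power_mono) auto
  finally show "norm (f $$ n) \<le> y ^ n / fact n" .
qed

lemma fps_majorized_product:
  assumes "\<And>j. j \<in> fst ` set xs \<Longrightarrow> norm (a j) \<le> L" "0 \<le> L"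
  shows "fps_majorized (total_time xs * L) (fps_product a xs)"
  using assms(1)
proof (induction xs)
  case Nil
  then show ?case by (auto simp: fps_majorized_def fps_one_def)
next
  case (Cons x xs)
  have "fps_majorized (\<bar>snd x\<bar> * L) (fps_Exp (snd x *\<^sub>R a (fst x)))"
    using Cons.prems by (intro fps_majorized_Exp) (auto intro!: mult_left_mono)
  then show ?case
    using Cons assms(2) by (simp add: distrib_right fps_majorized_mult)
qed

lemma summable_exp_real: "summable (\<lambda>n. x ^ n / fact n :: real)"
  using summable_exp_generic[of x] by (simp add: divide_inverse mult.commute)

lemma fps_majorized_summable_norm:
  "fps_majorized x f \<Longrightarrow> summable (\<lambda>n. norm (f $$ n))"
  by (rule summable_comparison_test'[OF summable_exp_real[of x], of 0]) (simp add: fps_majorized_def)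

section \<open>Evaluating the series in the Banach algebra\<close>

definition exp_list :: "('j \<Rightarrow> 'a::{real_normed_algebra_1,banach}) \<Rightarrow> ('j \<times> real) list \<Rightarrow> 'a" where
  "exp_list a xs = (\<Prod>(j, s)\<leftarrow>xs. exp (s *\<^sub>R a j))"

lemma exp_list_Nil [simp]: "exp_list a [] = 1"
  by (simp add: exp_list_def)

lemma exp_list_Cons [simp]: "exp_list a (x # xs) = exp (snd x *\<^sub>R a (fst x)) * exp_list a xs"
  by (simp add: exp_list_def split_beta)

lemma exp_list_append: "exp_list a (xs @ ys) = exp_list a xs * exp_list a ys"
  by (simp add: exp_list_def)

lemma exp_list_replicate: "exp_list a (concat (replicate r xs)) = exp_list a xs ^ r"
  by (induction r) (simp_all add: exp_list_append)

lemma norm_exp_list_le_1: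
  assumes "\<And>j s. j \<in> fst ` set xs \<Longrightarrow> norm (exp (s *\<^sub>R a j)) \<le> 1"
  shows "norm (exp_list a xs) \<le> 1"
  using assms
proof (induction xs)
  case (Cons x xs)
  have "norm (exp_list a (x # xs)) \<le> norm (exp (snd x *\<^sub>R a (fst x))) * norm (exp_list a xs)"
    by (simp add: norm_mult_ineq)
  also have "\<dots> \<le> 1 * 1"
    using Cons by (intro mult_mono) auto
  finally show ?case by simp
qed simp

text \<open>Evaluation at X = 1. The majorants give absolute convergence, so the Cauchy product
  turns a product of series into the product of their sums.\<close>

lemma suminf_fps_product:
  fixes a :: "'j \<Rightarrow> 'a::{real_normed_algebra_1,banach}"
  shows "(\<Sum>n. fps_product a xs $$ n) = exp_list a xs"
proof (induction xs)
  case Nil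
  have "(\<lambda>n. (1 :: 'a fps) $$ n) sums 1"
    using sums_single[of 0 "\<lambda>_. 1 :: 'a"] by (simp add: fps_one_def)
  then show ?case by (simp add: sums_iff)
next
  case (Cons x xs)
  \<comment> \<open>Only convergence is at stake, so any common bound serves. Inserting 0 keeps the
    maximum defined for empty \<open>xs\<close> and makes it nonnegative.\<close>
  define L where "L = Max (insert 0 ((\<lambda>j. norm (a j)) ` fst ` set xs))"
  have "fps_majorized (total_time xs * L) (fps_product a xs)"
    by (rule fps_majorized_product) (auto simp: L_def)
  then have "(\<lambda>n. (fps_Exp (snd x *\<^sub>R a (fst x)) * fps_product a xs) $$ n) sums
      ((\<Sum>n. fps_Exp (snd x *\<^sub>R a (fst x)) $$ n) * (\<Sum>n. fps_product a xs $$ n))"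
    unfolding fps_mult_nth atMost_atLeast0[symmetric]
    by (intro Cauchy_product_sums fps_majorized_summable_norm)
      (auto intro: fps_majorized_Exp)
  then show ?case
    using Cons by (simp add: sums_iff exp_def)
qed

text \<open>Terms below degree \<open>N\<close> cancel. In the tail
  \<open>fact n \<le> fact (n + N)\<close> lets \<open>x ^ N\<close> be pulled out of an exponential
  series; the 2 accounts for bounding both series.\<close>

lemma fps_agree_suminf_diff_le:
  fixes f g :: "'a::{real_normed_algebra_1,banach} fps"
  assumes "fps_agree N f g" "fps_majorized x f" "fps_majorized x g" "0 \<le> x"
  shows "norm ((\<Sum>n. f $$ n) - (\<Sum>n. g $$ n)) \<le> 2 * x ^ N * exp x"
proof -
  let ?d = "\<lambda>n. f $$ n - g $$ n"
  have sf: "summable (\<lambda>n. f $$ n)" and sg: "summable (\<lambda>n. g $$ n)"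
    using assms by (auto intro: summable_norm_cancel fps_majorized_summable_norm)
  have d: "norm (?d (n + N)) \<le> 2 * x ^ N * (x ^ n / fact n)" for n
  proof -
    have "norm (?d (n + N)) \<le> norm (f $$ (n + N)) + norm (g $$ (n + N))"
      by (rule norm_triangle_ineq4)
    also have "\<dots> \<le> 2 * (x ^ (n + N) / fact (n + N))"
      using assms(2,3) unfolding fps_majorized_def by (smt (verit))
    also have "\<dots> \<le> 2 * (x ^ (n + N) / fact n)"
      using assms(4) by (intro mult_left_mono divide_left_mono fact_mono) auto
    finally show ?thesis
      by (simp add: power_add mult_ac)
  qed
  have sx: "summable (\<lambda>n. 2 * x ^ N * (x ^ n / fact n))"
    by (intro summable_mult summable_exp_real)
  have "(\<Sum>n. f $$ n) - (\<Sum>n. g $$ n) = (\<Sum>n. ?d n)"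
    by (rule suminf_diff[OF sf sg])
  also have "\<dots> = (\<Sum>n. ?d (n + N))"
    using suminf_split_initial_segment[OF summable_diff[OF sf sg], of N] assms(1)
    by (simp add: fps_agree_def)
  also have "norm \<dots> \<le> (\<Sum>n. norm (?d (n + N)))"
    by (rule summable_norm, rule summable_comparison_test'[OF sx, of 0]) (use d in auto)
  also have "\<dots> \<le> (\<Sum>n. 2 * x ^ N * (x ^ n / fact n))"
    by (rule suminf_le[OF d _ sx], rule summable_comparison_test'[OF sx, of 0]) (use d in auto)
  also have "\<dots> = 2 * x ^ N * exp x"
    by (subst suminf_mult[OF summable_exp_real]) (simp add: exp_def divide_inverse mult.commute)
  finally show ?thesis .
qed

text \<open>Since \<open>u\<close> and \<open>v\<close> are contractions, the errors of successive
  time slices add up without amplification.\<close>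

lemma norm_power_diff_le:
  fixes u v :: "'a::real_normed_algebra_1"
  assumes "norm u \<le> 1" "norm v \<le> 1"
  shows "norm (u ^ n - v ^ n) \<le> real n * norm (u - v)"
proof (induction n)
  case (Suc n)
  have "norm v ^ n \<le> 1"
    using assms by (simp add: power_le_one)
  then have vn: "norm (v ^ n) \<le> 1"
    using norm_power_ineq[of v n] by linarith
  have "u ^ Suc n - v ^ Suc n = u * (u ^ n - v ^ n) + (u - v) * v ^ n"
    by (simp add: algebra_simps)
  also have "norm \<dots> \<le> norm u * norm (u ^ n - v ^ n) + norm (u - v) * norm (v ^ n)"
    by (intro norm_triangle_mono norm_mult_ineq)
  also have "\<dots> \<le> 1 * (real n * norm (u - v)) + norm (u - v) * 1"
    using Suc assms vn by (intro add_mono mult_mono) auto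
  finally show ?case
    by (simp add: algebra_simps)
qed simp

lemma exp_scaleR_of_nat:
  fixes x :: "'a::{real_normed_algebra_1,banach}"
  shows "exp (real n *\<^sub>R x) = exp x ^ n"
proof (induction n)
  case (Suc n)
  have "exp (x + real n *\<^sub>R x) = exp x * exp (real n *\<^sub>R x)"
    by (rule exp_add_commuting) simp
  then show ?case
    using Suc by (simp add: scaleR_add_left)
qed simp

text \<open>The time is cut into \<open>r\<close> equal slices, and the same Suzuki product is used
  in each. The number \<open>x\<close> bounds the total time of one slice multiplied by the
  generator bound \<open>L\<close>.\<close>

lemma suzuki_simulation:
  fixes a :: "nat \<Rightarrow> 'a::{real_normed_algebra_1,banach}" and k :: nat
  assumes bound: "\<And>j. j \<in> {1..m} \<Longrightarrow> norm (a j) \<le> L"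
    and contr: "\<And>j s. j \<in> {1..m} \<Longrightarrow> norm (exp (s *\<^sub>R a j)) \<le> 1"
      "\<And>s. norm (exp (s *\<^sub>R (\<Sum>j=1..m. a j))) \<le> 1"
    and nonneg: "0 \<le> L" "0 \<le> t" and r: "0 < r"
  defines "x \<equiv> real m * 5 ^ k * (L * t) / real r"
  shows "\<exists>xs. fst ` set xs \<subseteq> {1..m} \<and> length xs = 2 * m * 5 ^ k * r \<and>
    norm (exp_list a xs - exp (t *\<^sub>R (\<Sum>j=1..m. a j))) \<le> real r * (2 * x ^ (2 * k + 3) * exp x)"
proof -
  let ?A = "\<Sum>j=1..m. a j"
  define s where "s = t / real r"
  have s0: "0 \<le> s" using nonneg by (simp add: s_def)
  obtain ys where ys: "fst ` set ys \<subseteq> {1..m}" "length ys = 2 * m * 5 ^ k"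
    "total_time ys \<le> real m * 5 ^ k" "fps_agree (2 * k + 3) (fps_product a ys) (fps_Exp ?A)"
    using suzuki_sequence_exists[of m k a] by blast
  define zs where "zs = scale_times s ys"
  have zs: "fst ` set zs \<subseteq> {1..m}" "length zs = 2 * m * 5 ^ k"
    using ys by (simp_all add: zs_def)
  have agree: "fps_agree (2 * k + 3) (fps_product a zs) (fps_Exp (s *\<^sub>R ?A))"
    using fps_agree_dilate[OF ys(4)] by (simp add: zs_def fps_product_scale_times fps_dilate_Exp)
  have x: "x = s * (real m * 5 ^ k) * L" and x0: "0 \<le> x"
    using nonneg by (simp_all add: x_def s_def)
  have "total_time zs * L \<le> x"
    unfolding x zs_def using ys(3) nonneg s0 by (auto intro!: mult_right_mono mult_left_mono)
  then have maj1: "fps_majorized x (fps_product a zs)"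
    using bound zs(1) nonneg total_time_nonneg[of zs]
    by (intro fps_majorized_mono[OF fps_majorized_product[of zs a L]]) auto
  \<comment> \<open>The exact generator has norm at most \<open>m * L\<close>, and
    \<open>1 \<le> 5 ^ k\<close>, so the exact evolution has the same majorant as the
    product.\<close>
  have "norm ?A \<le> real m * L"
    using sum_norm_bound[of "{1..m}" a L] bound by auto
  also have "\<dots> \<le> real m * 5 ^ k * L"
    using nonneg by (intro mult_right_mono) (auto simp: mult_le_cancel_left1)
  finally have "s * norm ?A \<le> s * (real m * 5 ^ k * L)"
    using s0 by (rule mult_left_mono)
  then have maj2: "fps_majorized x (fps_Exp (s *\<^sub>R ?A))"
    using s0 by (intro fps_majorized_Exp) (simp add: x mult_ac)
  have step: "norm (exp_list a zs - exp (s *\<^sub>R ?A)) \<le> 2 * x ^ (2 * k + 3) * exp x"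
    using fps_agree_suminf_diff_le[OF agree maj1 maj2 x0]
    by (simp add: suminf_fps_product exp_def)
  have "norm (exp_list a (concat (replicate r zs)) - exp (real r *\<^sub>R s *\<^sub>R ?A))
      \<le> real r * norm (exp_list a zs - exp (s *\<^sub>R ?A))"
    unfolding exp_list_replicate exp_scaleR_of_nat
    using zs contr by (intro norm_power_diff_le norm_exp_list_le_1) auto
  also have "\<dots> \<le> real r * (2 * x ^ (2 * k + 3) * exp x)"
    using step by (intro mult_left_mono) auto
  also have "real r *\<^sub>R s *\<^sub>R ?A = t *\<^sub>R ?A"
    using r by (simp add: s_def)
  finally show ?thesis
    using zs r by (intro exI[of _ "concat (replicate r zs)"])
      (auto simp: length_concat sum_list_replicate)
qed

section \<open>The Banach algebra of bounded endomorphisms\<close>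

text \<open>The type of bounded linear maps has no multiplicative structure in the library, so
  that \<open>exp\<close> is not available on it; the copy below is a Banach algebra.\<close>

typedef (overloaded) ('a::real_normed_vector) endo = "UNIV :: ('a \<Rightarrow>\<^sub>L 'a) set"
  by simp

setup_lifting type_definition_endo

instantiation endo :: (real_normed_vector) real_normed_vector
begin

lift_definition norm_endo :: "'a endo \<Rightarrow> real" is norm .
lift_definition zero_endo :: "'a endo" is 0 .
lift_definition plus_endo :: "'a endo \<Rightarrow> 'a endo \<Rightarrow> 'a endo" is "(+)" .
lift_definition minus_endo :: "'a endo \<Rightarrow> 'a endo \<Rightarrow> 'a endo" is "(-)" .
lift_definition uminus_endo :: "'a endo \<Rightarrow> 'a endo" is uminus .
lift_definition scaleR_endo :: "real \<Rightarrow> 'a endo \<Rightarrow> 'a endo" is "(*\<^sub>R)" .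

definition dist_endo :: "'a endo \<Rightarrow> 'a endo \<Rightarrow> real"
  where "dist_endo a b = norm (a - b)"

definition [code del]:
  "(uniformity :: ('a endo \<times> 'a endo) filter) = (INF e\<in>{0 <..}. principal {(x, y). dist x y < e})"

definition open_endo :: "'a endo set \<Rightarrow> bool"
  where [code del]: "open_endo S = (\<forall>x\<in>S. \<forall>\<^sub>F (x', y) in uniformity. x' = x \<longrightarrow> y \<in> S)"

definition sgn_endo :: "'a endo \<Rightarrow> 'a endo"
  where "sgn_endo x = inverse (norm x) *\<^sub>R x"

instance
  apply standard
  unfolding dist_endo_def open_endo_def sgn_endo_def uniformity_endo_def
  by (rule refl | (transfer, simp add: algebra_simps norm_triangle_ineq))+

end

text \<open>The sort \<open>perfect_space\<close> excludes the trivial space, on which the identity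
  would equal 0.\<close>

instantiation endo :: ("{real_normed_vector,perfect_space}") real_normed_algebra_1
begin

lift_definition one_endo :: "'a endo" is id_blinfun .
lift_definition times_endo :: "'a endo \<Rightarrow> 'a endo \<Rightarrow> 'a endo" is blinfun_compose .

instance
proof
  show "(0 :: 'a endo) \<noteq> 1"
    by transfer (metis norm_blinfun_id norm_zero zero_neq_one)
qed (transfer; auto intro!: blinfun_eqI simp: blinfun.bilinear_simps norm_blinfun_compose)+

end

instance endo :: (banach) banach
proof
  fix X :: "nat \<Rightarrow> 'a endo"
  assume "Cauchy X"
  then have "Cauchy (\<lambda>n. Rep_endo (X n))"
    by (simp add: Cauchy_def dist_norm norm_endo.rep_eq minus_endo.rep_eq)
  then obtain l where "(\<lambda>n. Rep_endo (X n)) \<longlonglongrightarrow> l"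
    using Cauchy_convergent convergent_def by blast
  then have "X \<longlonglongrightarrow> Abs_endo l"
    by (simp add: LIMSEQ_def dist_norm norm_endo.rep_eq minus_endo.rep_eq Abs_endo_inverse)
  then show "convergent X"
    by (rule convergentI)
qed

lift_definition endo_apply :: "'a::real_normed_vector endo \<Rightarrow> 'a \<Rightarrow> 'a" is blinfun_apply .

lemma endo_eqI: "(\<And>x. endo_apply f x = endo_apply g x) \<Longrightarrow> f = g"
  by transfer (rule blinfun_eqI)

lemma endo_apply_simps [simp]:
  "endo_apply 0 x = 0" "endo_apply (f + g) x = endo_apply f x + endo_apply g x"
  "endo_apply (f - g) x = endo_apply f x - endo_apply g x"
  "endo_apply (- f) x = - endo_apply f x"
  "endo_apply (c *\<^sub>R f) x = c *\<^sub>R endo_apply f x"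
  by (transfer; simp add: blinfun.bilinear_simps)+

lemma endo_apply_mult [simp]:
  fixes f g :: "'a::{real_normed_vector,perfect_space} endo"
  shows "endo_apply (f * g) x = endo_apply f (endo_apply g x)"
    and "endo_apply 1 x = (x :: 'a)"
  by (transfer; simp)+

lemma norm_endo_apply: "norm (endo_apply f x) \<le> norm f * norm x"
  by transfer (rule norm_blinfun)

lemma norm_endo_le: "0 \<le> b \<Longrightarrow> (\<And>x. norm (endo_apply f x) \<le> b * norm x) \<Longrightarrow> norm f \<le> b"
  by transfer (rule norm_blinfun_bound)

lemma bounded_linear_endo_apply: "bounded_linear (\<lambda>f. endo_apply f x)"
  by (rule bounded_linear_intro[where K="norm x"])
    (auto simp: norm_endo_apply)

text \<open>Adjointness passes to powers and then, by continuity of the inner product and of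
  evaluation, termwise to the exponential series.\<close>

lemma inner_exp_endo:
  fixes A B :: "'a::{real_inner,banach,perfect_space} endo"
  assumes adj: "\<And>x y. endo_apply A x \<bullet> y = x \<bullet> endo_apply B y"
  shows "endo_apply (exp A) x \<bullet> y = x \<bullet> endo_apply (exp B) y"
proof -
  \<comment> \<open>Taking adjoints reverses the order of factors, so \<open>B\<close> has to be
    moved past its own powers.\<close>
  have "endo_apply B (endo_apply (B ^ n) y) = endo_apply (B ^ n) (endo_apply B y)" for n y
    by (simp add: power_commutes flip: endo_apply_mult)
  then have pow: "endo_apply (A ^ n) x \<bullet> y = x \<bullet> endo_apply (B ^ n) y" for n x y
    by (induction n arbitrary: x y) (simp_all add: adj)
  have "(\<lambda>n. endo_apply (A ^ n /\<^sub>R fact n) x \<bullet> y) sums (endo_apply (exp A) x \<bullet> y)"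
    by (intro bounded_linear.sums[OF bounded_linear_inner_left]
        bounded_linear.sums[OF bounded_linear_endo_apply] exp_converges)
  moreover have "(\<lambda>n. x \<bullet> endo_apply (B ^ n /\<^sub>R fact n) y) sums (x \<bullet> endo_apply (exp B) y)"
    by (intro bounded_linear.sums[OF bounded_linear_inner_right]
        bounded_linear.sums[OF bounded_linear_endo_apply] exp_converges)
  ultimately show ?thesis
    by (simp add: pow sums_unique2)
qed

text \<open>The adjoint of \<open>exp A\<close> is \<open>exp (- A)\<close>, which is also its
  inverse. The real inner product suffices, as it determines the norm.\<close>

lemma norm_exp_skew:
  fixes A :: "'a::{real_inner,banach,perfect_space} endo"
  assumes "\<And>x y. endo_apply A x \<bullet> y = - (x \<bullet> endo_apply A y)"
  shows "norm (endo_apply (exp A) x) = norm x"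
proof -
  have "endo_apply (exp A) x \<bullet> endo_apply (exp A) x = x \<bullet> endo_apply (exp (- A)) (endo_apply (exp A) x)"
    by (rule inner_exp_endo) (simp add: assms)
  also have "\<dots> = x \<bullet> endo_apply (exp (- A) * exp A) x"
    by simp
  also have "exp (- A) * exp A = 1"
    using exp_minus_inverse[of "- A"] by simp
  finally show ?thesis
    by (simp add: norm_eq_sqrt_inner)
qed

section \<open>Matrices as endomorphisms\<close>

text \<open>Transports matrices to an algebra whose norm is the operator norm; the norm of the
  matrix type itself is the Euclidean norm of the entries.\<close>

definition endo_of :: "complex^'n^'n \<Rightarrow> (complex^'n) endo" where
  "endo_of M = Abs_endo (Blinfun ((*v) M))"

lemma bounded_linear_matrix_vector_mult_complex:
  "bounded_linear ((*v) (M :: complex^'n^'m))"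
proof -
  have "linear ((*v) M)"
    by (rule linearI) (simp_all add: matrix_vector_right_distrib matrix_vector_mult_def vec_eq_iff
        sum.distrib algebra_simps scaleR_sum_right)
  then show ?thesis
    by (simp add: linear_conv_bounded_linear)
qed

lemma endo_apply_endo_of [simp]: "endo_apply (endo_of M) x = M *v x"
  unfolding endo_of_def
  by (simp add: endo_apply.abs_eq bounded_linear_Blinfun_apply[OF bounded_linear_matrix_vector_mult_complex])

lemma norm_endo_of: "norm (endo_of M) = op_norm M"
  unfolding endo_of_def op_norm_def norm_endo.abs_eq norm_blinfun.rep_eq
  by (simp add: bounded_linear_Blinfun_apply[OF bounded_linear_matrix_vector_mult_complex])

lemma endo_of_mult: "endo_of (A ** B) = endo_of A * endo_of B"
  by (rule endo_eqI) (simp add: matrix_vector_mul_assoc)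

lemma endo_of_one: "endo_of (mat 1) = 1"
  by (rule endo_eqI) simp

lemma endo_of_mat_pow: "endo_of (mat_pow A n) = endo_of A ^ n"
  by (induction n) (simp_all add: mat_pow_def endo_of_one endo_of_mult)

lemma linear_endo_of: "linear (endo_of :: complex^'n^'n \<Rightarrow> _)"
  by (rule linearI; rule endo_eqI)
    (simp_all add: matrix_vector_mult_def vec_eq_iff sum.distrib algebra_simps scaleR_sum_right)

lemma bounded_linear_endo_of: "bounded_linear (endo_of :: complex^'n^'n \<Rightarrow> _)"
  using linear_endo_of by (simp add: linear_conv_bounded_linear)

text \<open>A crude equivalence of norms. It turns convergence of the exponential series in operator
  norm into convergence of the matrix series in \<open>mat_exp\<close>.\<close>

lemma norm_matrix_le_endo_of:
  fixes M :: "complex^'n^'n"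
  shows "norm M \<le> real CARD('n) * real CARD('n) * norm (endo_of M)"
proof -
  have entry: "norm (M $ i $ j) \<le> norm (endo_of M)" for i j
  proof -
    have "M $ i $ j = (M *v axis j 1) $ i"
      by (simp add: matrix_vector_mult_def axis_def if_distrib cong: if_cong)
    also have "norm \<dots> \<le> norm (M *v axis j 1)"
      by (rule Finite_Cartesian_Product.norm_nth_le)
    also have "\<dots> \<le> norm (endo_of M)"
      using norm_endo_apply[of "endo_of M" "axis j 1"] by simp
    finally show ?thesis .
  qed
  have l1: "norm v \<le> (\<Sum>i\<in>UNIV. norm (v $ i))" for v :: "'b::real_normed_vector^'n"
    by (simp add: norm_vec_def L2_set_le_sum)
  have "norm M \<le> (\<Sum>i\<in>UNIV. norm (M $ i))"
    by (rule l1)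
  also have "\<dots> \<le> (\<Sum>i\<in>UNIV. \<Sum>j\<in>UNIV. norm (M $ i $ j))"
    by (intro sum_mono l1)
  also have "\<dots> \<le> (\<Sum>i\<in>(UNIV::'n set). \<Sum>j\<in>(UNIV::'n set). norm (endo_of M))"
    by (intro sum_mono entry)
  finally show ?thesis
    by simp
qed

lemma endo_of_mat_exp: "endo_of (mat_exp A) = exp (endo_of A)"
proof -
  let ?f = "\<lambda>n. (1 / fact n) *\<^sub>R mat_pow A n"
  have coeff: "endo_of (?f n) = endo_of A ^ n /\<^sub>R fact n" for n
    by (simp add: linear_cmul[OF linear_endo_of] endo_of_mat_pow inverse_eq_divide)
  have "summable ?f"
  proof (rule summable_comparison_test')
    show "summable (\<lambda>n. real CARD('a) * real CARD('a) * norm (endo_of A ^ n /\<^sub>R fact n))"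
      by (intro summable_mult summable_norm_exp)
    show "norm (?f n) \<le> real CARD('a) * real CARD('a) * norm (endo_of A ^ n /\<^sub>R fact n)" for n
      using norm_matrix_le_endo_of[of "?f n"] by (simp only: coeff)
  qed
  from bounded_linear.suminf[OF bounded_linear_endo_of this] show ?thesis
    by (simp add: mat_exp_def exp_def coeff)
qed

lemma endo_of_evol:
  "endo_of (evol H t) = exp (t *\<^sub>R endo_of (map_matrix (\<lambda>z. - \<i> * z) H))"
proof -
  have "map_matrix (\<lambda>z. - \<i> * complex_of_real t * z) H = t *\<^sub>R map_matrix (\<lambda>z. - \<i> * z) H"
    by (simp add: map_matrix_def vec_eq_iff scaleR_conv_of_real[where 'a=complex])
  then show ?thesis
    by (simp add: evol_def endo_of_mat_exp linear_cmul[OF linear_endo_of])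
qed

lemma matrix_vector_mult_map_mult:
  fixes A :: "complex^'n^'m"
  shows "map_matrix (\<lambda>z. c * z) A *v x = (\<chi> i. c * (A *v x) $ i)"
  by (simp add: map_matrix_def matrix_vector_mult_def vec_eq_iff sum_distrib_left mult.assoc)

lemma inner_eq_Re_cinner: "x \<bullet> y = Re (cinner x y)"
  by (simp add: inner_vec_def cinner_def inner_complex_def)

lemma cinner_adj: "cinner (A *v x) y = cinner x (adj A *v y)"
proof -
  have "cinner (A *v x) y = (\<Sum>i\<in>UNIV. \<Sum>j\<in>UNIV. cnj (A $ i $ j) * cnj (x $ j) * y $ i)"
    by (simp add: cinner_def matrix_vector_mult_def sum_distrib_right)
  also have "\<dots> = (\<Sum>j\<in>UNIV. \<Sum>i\<in>UNIV. cnj (A $ i $ j) * cnj (x $ j) * y $ i)"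
    by (rule sum.swap)
  also have "\<dots> = cinner x (adj A *v y)"
    by (simp add: cinner_def matrix_vector_mult_def sum_distrib_left adj_def mult_ac)
  finally show ?thesis .
qed

text \<open>The scalar \<open>- \<i>\<close> is conjugated when it leaves the first argument of
  \<open>cinner\<close>, but not when it leaves the second, which produces the opposite
  signs.\<close>

lemma skew_hermitian:
  assumes "hermitian H"
  defines "A \<equiv> endo_of (map_matrix (\<lambda>z. - \<i> * z) H)"
  shows "endo_apply (t *\<^sub>R A) x \<bullet> y = - (x \<bullet> endo_apply (t *\<^sub>R A) y)"
proof -
  have "cinner (H *v x) y = cinner x (H *v y)"
    using assms(1) by (simp add: cinner_adj hermitian_def)
  moreover have "cinner (endo_apply A x) y = \<i> * cinner (H *v x) y"
    "cinner x (endo_apply A y) = - \<i> * cinner x (H *v y)"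
    unfolding A_def endo_apply_endo_of matrix_vector_mult_map_mult
    by (simp_all add: cinner_def sum_distrib_left mult_ac sum_negf)
  ultimately have "endo_apply A x \<bullet> y = - (x \<bullet> endo_apply A y)"
    by (simp add: inner_eq_Re_cinner)
  then show ?thesis
    by simp
qed

lemma norm_evol:
  assumes "hermitian H"
  shows "norm (evol H t *v x) = norm x"
proof -
  have "norm (endo_apply (endo_of (evol H t)) x) = norm x"
    unfolding endo_of_evol by (rule norm_exp_skew) (rule skew_hermitian[OF assms])
  then show ?thesis by simp
qed

lemma norm_endo_of_generator: "norm (endo_of (map_matrix (\<lambda>z. - \<i> * z) H)) = op_norm H"
proof -
  have "norm (map_matrix (\<lambda>z. - \<i> * z) H *v x) = norm (H *v x)" for x
    unfolding matrix_vector_mult_map_mult by (simp add: norm_vec_def norm_mult)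
  then show ?thesis
    by (simp add: norm_endo_of op_norm_def onorm_def)
qed

lemma matrix_vector_mult_scaleR_complex:
  "(M :: complex^'n^'m) *v (c *\<^sub>R x) = c *\<^sub>R (M *v x)"
  by (rule linear_cmul[OF bounded_linear.linear[OF bounded_linear_matrix_vector_mult_complex]])

lemma scaleR_matrix_vector_mult_complex:
  "(c *\<^sub>R M :: complex^'n^'m) *v x = c *\<^sub>R (M *v x)"
  by (simp add: matrix_vector_mult_def vec_eq_iff scaleR_sum_right)

section \<open>Trace distance of pure states\<close>

lemma adj_mult: "adj (A ** B) = adj B ** adj A"
  by (simp add: adj_def matrix_matrix_mult_def vec_eq_iff mult.commute)

lemma adj_scaleR: "adj (c *\<^sub>R A) = c *\<^sub>R adj A"
  by (simp add: adj_def vec_eq_iff)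

lemma hermitian_inner: "hermitian A \<Longrightarrow> (A *v x) \<bullet> y = x \<bullet> (A *v y)"
  by (simp add: inner_eq_Re_cinner cinner_adj hermitian_def)

lemma pos_semidef_square:
  assumes "hermitian A" "0 \<le> c"
  shows "pos_semidef (c *\<^sub>R (A ** A))"
proof -
  have "x \<bullet> ((c *\<^sub>R (A ** A)) *v x) = c * ((A *v x) \<bullet> (A *v x))" for x
    using hermitian_inner[OF assms(1), of x "A *v x"]
    by (simp add: scaleR_matrix_vector_mult_complex flip: matrix_vector_mul_assoc)
  then show ?thesis
    using assms
    by (simp add: pos_semidef_def flip: inner_eq_Re_cinner) (simp add: hermitian_def adj_mult adj_scaleR)
qed

text \<open>If \<open>Q\<close> is positive with \<open>Q\<^sup>4 = s\<^sup>2 Q\<^sup>2\<close>, then \<open>(Q + s) Q (Q - s) Q = 0\<close>, and \<open>Q + s\<close> is injective.\<close>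

lemma pos_semidef_sqrt_unique:
  assumes Q: "pos_semidef Q" and s: "0 < s"
    and fourth: "(Q ** Q) ** (Q ** Q) = s\<^sup>2 *\<^sub>R (Q ** Q)"
  shows "Q = (1 / s) *\<^sub>R (Q ** Q)"
proof -
  have herm: "hermitian Q" using Q by (simp add: pos_semidef_def)
  have "Q *v (Q *v x) = s *\<^sub>R (Q *v x)" for x
  proof -
    define r where "r = Q *v (Q *v x) - s *\<^sub>R (Q *v x)"
    define y where "y = Q *v r"
    have "((Q ** Q) ** (Q ** Q)) *v x = (s\<^sup>2 *\<^sub>R (Q ** Q)) *v x"
      by (simp only: fourth)
    then have "Q *v (Q *v (Q *v (Q *v x))) = s\<^sup>2 *\<^sub>R (Q *v (Q *v x))"
      by (simp add: scaleR_matrix_vector_mult_complex flip: matrix_vector_mul_assoc)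
    then have "Q *v y = - (s *\<^sub>R y)"
      by (simp add: y_def r_def matrix_vector_mult_diff_distrib matrix_vector_mult_scaleR_complex
          algebra_simps power2_eq_square)
    moreover have "0 \<le> y \<bullet> (Q *v y)"
      using Q by (simp add: pos_semidef_def inner_eq_Re_cinner)
    ultimately have "s * (y \<bullet> y) \<le> 0" by simp
    then have "y \<bullet> y = 0"
      using s by (metis inner_ge_zero less_eq_real_def mult_pos_pos not_le)
    then have "Q *v r = 0" by (simp add: y_def)
    \<comment> \<open>The vector \<open>r\<close> lies both in the kernel and in the range of the
      Hermitian \<open>Q\<close>, so it is orthogonal to itself.\<close>
    then have "r \<bullet> (Q *v (Q *v x)) = 0" "r \<bullet> (Q *v x) = 0"
      using hermitian_inner[OF herm, of r] by (metis inner_zero_left)+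
    then have "r \<bullet> r = 0"
      by (subst (2) r_def) (simp add: inner_diff_right)
    then show ?thesis by (simp add: r_def)
  qed
  then show ?thesis
    using s by (simp add: matrix_eq scaleR_matrix_vector_mult_complex flip: matrix_vector_mul_assoc)
qed

text \<open>From \<open>A^3 = s^2 A\<close> the positive matrix \<open>A^2 / s\<close> squares to
  \<open>A^2\<close>. Any other positive root \<open>Q\<close> satisfies
  \<open>Q^4 = s^2 Q^2\<close>, so the uniqueness lemma identifies it.\<close>

lemma mat_abs_cube:
  assumes A: "hermitian A" and s: "0 < s" and cube: "A ** (A ** A) = s\<^sup>2 *\<^sub>R A"
  shows "mat_abs A = (1 / s) *\<^sub>R (A ** A)"
proof -
  have adjA: "adj A = A" using A by (simp add: hermitian_def)
  have cube': "A *v (A *v (A *v x)) = s\<^sup>2 *\<^sub>R (A *v x)" for x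
    using arg_cong[OF cube, of "\<lambda>M. M *v x"]
    by (simp add: scaleR_matrix_vector_mult_complex flip: matrix_vector_mul_assoc)
  have fourth: "(A ** A) ** (A ** A) = s\<^sup>2 *\<^sub>R (A ** A)"
    by (simp add: matrix_eq cube' scaleR_matrix_vector_mult_complex
        matrix_vector_mult_scaleR_complex flip: matrix_vector_mul_assoc)
  show ?thesis
    unfolding mat_abs_def adjA
  proof (rule the_equality)
    let ?P = "(1 / s) *\<^sub>R (A ** A)"
    have "?P ** ?P = A ** A"
      using s
      by (simp add: matrix_eq cube' scaleR_matrix_vector_mult_complex power2_eq_square
          matrix_vector_mult_scaleR_complex flip: matrix_vector_mul_assoc)
    then show "pos_semidef ?P \<and> ?P ** ?P = A ** A"
      using s A by (auto intro: pos_semidef_square)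
  next
    fix Q assume "pos_semidef Q \<and> Q ** Q = A ** A"
    then show "Q = (1 / s) *\<^sub>R (A ** A)"
      using pos_semidef_sqrt_unique[of Q s] s fourth by simp
  qed
qed

lemma hermitian_square_eq_0:
  assumes "hermitian A" "A ** A = 0"
  shows "A = 0"
proof -
  have "(A *v x) \<bullet> (A *v x) = 0" for x
    using hermitian_inner[OF assms(1), of x "A *v x"] assms(2)
    by (simp add: matrix_vector_mul_assoc)
  then show ?thesis
    by (simp add: matrix_eq)
qed

text \<open>Covers the case of coinciding pure states, where the eigenvalue \<open>s\<close> of
  \<open>mat_abs_cube\<close> would be 0.\<close>

lemma mat_abs_0: "mat_abs 0 = (0 :: complex^'n^'n)"
  unfolding mat_abs_def
proof (rule the_equality)
  have "hermitian (0 :: complex^'n^'n)"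
    by (simp add: hermitian_def adj_def vec_eq_iff)
  then show "pos_semidef (0 :: complex^'n^'n) \<and> 0 ** 0 = adj (0 :: complex^'n^'n) ** 0"
    by (simp add: pos_semidef_def cinner_def)
next
  fix P :: "complex^'n^'n"
  assume "pos_semidef P \<and> P ** P = adj 0 ** 0"
  then show "P = 0"
    using hermitian_square_eq_0[of P] by (simp add: pos_semidef_def)
qed

lemma pure_state_mult_vector: "pure_state \<psi> *v x = cinner \<psi> x *s \<psi>"
  by (simp add: pure_state_def cinner_def matrix_vector_mult_def vec_eq_iff sum_distrib_left mult_ac)

lemma hermitian_pure_state_diff: "hermitian (pure_state \<psi> - pure_state \<phi>)"
  by (simp add: hermitian_def adj_def pure_state_def vec_eq_iff mult.commute)

lemma trace_pure_state_mult:
  "trace (pure_state \<psi> ** pure_state \<phi>) = cinner \<psi> \<phi> * cinner \<phi> \<psi>"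
proof -
  have "trace (pure_state \<psi> ** pure_state \<phi>) =
      (\<Sum>i\<in>UNIV. \<Sum>k\<in>UNIV. (cnj (\<phi> $ i) * \<psi> $ i) * (cnj (\<psi> $ k) * \<phi> $ k))"
    by (simp add: trace_def matrix_matrix_mult_def pure_state_def mult_ac)
  also have "\<dots> = cinner \<phi> \<psi> * cinner \<psi> \<phi>"
    by (simp add: cinner_def sum_product)
  finally show ?thesis by simp
qed

lemma cinner_commute: "cinner y x = cnj (cinner x y)"
  by (simp add: cinner_def mult.commute)

lemma cinner_self: "cinner x x = complex_of_real ((norm x)\<^sup>2)"
proof -
  have "Im (cinner x x) = 0"
    using cinner_commute[of x x] by (simp add: complex_eq_iff)
  moreover have "Re (cinner x x) = (norm x)\<^sup>2"
    by (simp add: power2_norm_eq_inner flip: inner_eq_Re_cinner)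
  ultimately show ?thesis
    by (simp add: complex_eq_iff)
qed

text \<open>The difference \<open>A\<close> of the two projectors has eigenvalues \<open>\<plusminus>s\<close> with
  \<open>s\<^sup>2 = 1 - |\<langle>\<psi>|\<phi>\<rangle>|\<^sup>2\<close>, so that \<open>A\<^sup>3 = s\<^sup>2 A\<close>.\<close>

lemma trace_distance_pure_state:
  fixes \<psi> \<phi> :: "complex^'n"
  assumes unit: "norm \<psi> = 1" "norm \<phi> = 1"
  shows "trace_distance (pure_state \<psi>) (pure_state \<phi>) = sqrt (1 - (cmod (cinner \<psi> \<phi>))\<^sup>2)"
proof -
  define c where "c = cinner \<psi> \<phi>"
  define S where "S = 1 - (cmod c)\<^sup>2"
  define A where "A = pure_state \<psi> - pure_state \<phi>"
  have herm: "hermitian A"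
    unfolding A_def by (rule hermitian_pure_state_diff)
  have inner: "cinner \<psi> \<psi> = 1" "cinner \<phi> \<phi> = 1" "cinner \<psi> \<phi> = c" "cinner \<phi> \<psi> = cnj c"
    using unit cinner_commute[of \<phi> \<psi>] by (simp_all add: cinner_self c_def)
  have Ax: "A *v x = cinner \<psi> x *s \<psi> - cinner \<phi> x *s \<phi>" for x
    by (simp add: A_def matrix_vector_mult_diff_rdistrib pure_state_mult_vector)
  have A_scale: "A *v (z *s x) = z *s (A *v x)" for z x
    by (rule vector_scalar_commute)
  have cc: "c * cnj c = complex_of_real ((cmod c)\<^sup>2)"
    by (rule complex_norm_square[symmetric])
  have Apsi: "A *v \<psi> = \<psi> - cnj c *s \<phi>" and Aphi: "A *v \<phi> = c *s \<psi> - \<phi>"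
    by (simp_all add: Ax inner)
  have AApsi: "A *v (A *v \<psi>) = S *\<^sub>R \<psi>"
    unfolding Apsi matrix_vector_mult_diff_distrib A_scale Aphi
    using cc by (simp add: vec_eq_iff S_def scaleR_conv_of_real[where 'a=complex] algebra_simps)
  have AAphi: "A *v (A *v \<phi>) = S *\<^sub>R \<phi>"
    unfolding Aphi matrix_vector_mult_diff_distrib A_scale Apsi
    using cc by (simp add: vec_eq_iff S_def scaleR_conv_of_real[where 'a=complex] algebra_simps)
  \<comment> \<open>The range of \<open>A\<close> lies in the span of \<open>\<psi>\<close> and
    \<open>\<phi>\<close>, where \<open>A\<close> squared acts as the scalar
    \<open>S\<close>.\<close>
  have cube: "A ** (A ** A) = S *\<^sub>R A"
  proof -
    have "A *v (A *v (A *v x)) = S *\<^sub>R (A *v x)" for x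
      by (subst Ax[of x])
        (simp add: matrix_vector_mult_diff_distrib A_scale AApsi AAphi Ax[of x] vec_eq_iff algebra_simps)
    then show ?thesis
      by (simp add: matrix_eq scaleR_matrix_vector_mult_complex flip: matrix_vector_mul_assoc)
  qed
  \<comment> \<open>Being a squared norm, \<open>S\<close> is nonnegative; this amounts to the
    Cauchy-Schwarz inequality for \<open>c\<close>.\<close>
  have "S = (A *v \<psi>) \<bullet> (A *v \<psi>)"
    using hermitian_inner[OF herm, of \<psi> "A *v \<psi>"] unit
    by (simp add: AApsi flip: power2_norm_eq_inner)
  then have S0: "0 \<le> S" by simp
  have "trace (A ** A) = complex_of_real (2 * S)"
  proof -
    have "A ** A = pure_state \<psi> ** pure_state \<psi> - pure_state \<psi> ** pure_state \<phi>
        - (pure_state \<phi> ** pure_state \<psi> - pure_state \<phi> ** pure_state \<phi>)"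
      by (simp add: A_def matrix_eq matrix_vector_mult_diff_rdistrib matrix_vector_mult_diff_distrib
          flip: matrix_vector_mul_assoc)
    then show ?thesis
      using cc by (simp add: trace_sub trace_pure_state_mult inner S_def mult.commute)
  qed
  then have tr: "Re (trace (A ** A)) = 2 * S" by simp
  have "Re (trace (mat_abs A)) / 2 = sqrt S"
  proof (cases "S = 0")
    case True
    then have "(A ** A) ** (A ** A) = 0"
      using cube by (simp flip: matrix_mul_assoc)
    moreover have "hermitian (A ** A)"
      using herm by (simp add: hermitian_def adj_mult)
    ultimately have "A ** A = 0"
      by (rule hermitian_square_eq_0[rotated])
    then have "A = 0"
      by (rule hermitian_square_eq_0[OF herm])
    then show ?thesis
      using True by (simp add: mat_abs_0 trace_def)
  next
    case False
    then have "mat_abs A = (1 / sqrt S) *\<^sub>R (A ** A)"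
      using S0 cube herm by (intro mat_abs_cube) auto
    then have "Re (trace (mat_abs A)) = (1 / sqrt S) * Re (trace (A ** A))"
      by (simp add: trace_def sum_divide_distrib)
    then show ?thesis
      using tr False S0 by (simp add: real_div_sqrt)
  qed
  then show ?thesis
    by (simp add: trace_distance_def A_def S_def c_def)
qed

text \<open>With \<open>c\<close> the modulus of the overlap, the squared distance is at least
  \<open>2 - 2 * c\<close>, and this exceeds \<open>1 - c^2\<close> by the square
  \<open>(1 - c)^2\<close>.\<close>

lemma trace_distance_pure_state_le:
  assumes "norm \<psi> = 1" "norm \<phi> = 1"
  shows "trace_distance (pure_state \<psi>) (pure_state \<phi>) \<le> norm (\<psi> - \<phi>)"
proof -
  let ?c = "cmod (cinner \<psi> \<phi>)"
  have "\<psi> \<bullet> \<phi> \<le> ?c"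
    unfolding inner_eq_Re_cinner by (rule complex_Re_le_cmod)
  moreover have "0 \<le> (1 - ?c)\<^sup>2" by simp
  moreover have "(norm (\<psi> - \<phi>))\<^sup>2 = 2 - 2 * (\<psi> \<bullet> \<phi>)"
    using assms
    by (simp add: power2_norm_eq_inner inner_diff inner_commute
        flip: power2_norm_eq_inner[of \<psi>] power2_norm_eq_inner[of \<phi>])
  ultimately have "1 - ?c\<^sup>2 \<le> (norm (\<psi> - \<phi>))\<^sup>2"
    by (simp add: power2_eq_square algebra_simps)
  then show ?thesis
    unfolding trace_distance_pure_state[OF assms] by (rule real_le_lsqrt[rotated]) simp
qed

lemma sim_error_le:
  fixes U V :: "complex^'n^'n"
  assumes "\<And>x. norm (V *v x) = norm x" "\<And>x. norm (U *v x) = norm x"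
    and le: "op_norm (V - U) \<le> \<epsilon>"
  shows "sim_error V U \<le> \<epsilon>"
  unfolding sim_error_def
proof (rule cSUP_least)
  have "norm (axis undefined 1 :: complex^'n) = 1" by simp
  then show "{\<psi> :: complex^'n. norm \<psi> = 1} \<noteq> {}" by blast
next
  fix \<psi> :: "complex^'n"
  assume \<psi>: "\<psi> \<in> {\<psi>. norm \<psi> = 1}"
  have "trace_distance (pure_state (V *v \<psi>)) (pure_state (U *v \<psi>)) \<le> norm (V *v \<psi> - U *v \<psi>)"
    using assms \<psi> by (intro trace_distance_pure_state_le) auto
  also have "\<dots> = norm (endo_apply (endo_of (V - U)) \<psi>)"
    by (simp add: matrix_vector_mult_diff_rdistrib)
  also have "\<dots> \<le> op_norm (V - U)"
    using norm_endo_apply[of "endo_of (V - U)" \<psi>] \<psi> by (simp add: norm_endo_of)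
  finally show "trace_distance (pure_state (V *v \<psi>)) (pure_state (U *v \<psi>)) \<le> \<epsilon>"
    using le by linarith
qed

section \<open>Number of time slices\<close>

text \<open>Here \<open>z\<close> stands for \<open>m * \<tau>\<close>. Once \<open>exp x\<close> is
  bounded by 3, the error is at most \<open>3 * M ^ (2 * k + 1) / (2 * r) ^ (2 * k)\<close>, so
  \<open>r\<close> must be of the order of \<open>Y\<close>, where
  \<open>Y ^ (2 * k) = M ^ (2 * k + 1) / \<epsilon>\<close>.\<close>

lemma suzuki_step_count:
  fixes z \<epsilon> :: real
  assumes k: "1 \<le> k" and eps: "0 < \<epsilon>" "\<epsilon> \<le> 1" and large: "1 \<le> 2 * 5 ^ (k - 1) * z"
  obtains r :: nat where "0 < r"
    "real r * (2 * (5 ^ (k - 1) * z / real r) ^ (2 * k + 1) * exp (5 ^ (k - 1) * z / real r)) \<le> \<epsilon>"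
    "real r \<le> 5 ^ (k + 1) * z powr (1 + 1 / (2 * real k)) / \<epsilon> powr (1 / (2 * real k))"
proof -
  define q where "q = 1 / (2 * real k)"
  define B :: real where "B = 2 * 5 ^ (k - 1)"
  define M where "M = B * z"
  define Y where "Y = M powr (1 + q) / \<epsilon> powr q"
  define r where "r = nat \<lceil>2 * Y\<rceil>"
  have q0: "0 < q" and qk: "q * real (2 * k) = 1"
    using k by (auto simp: q_def)
  have B1: "1 \<le> B"
    using one_le_power[of "5 :: real" "k - 1"] unfolding B_def by linarith
  have M1: "1 \<le> M"
    using large by (simp add: M_def B_def)
  have z0: "0 < z"
    using M1 B1 by (intro zero_less_mult_pos[of B z]) (auto simp: M_def)
  have "1 \<le> M powr (1 + q)"
    using M1 q0 by (intro ge_one_powr_ge_zero) auto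
  moreover have MY: "M powr (1 + q) \<le> Y"
    using eps q0 powr_le1[of q \<epsilon>] by (simp add: Y_def le_divide_eq mult_left_le)
  ultimately have Y1: "1 \<le> Y" by linarith
  have "M powr 1 \<le> M powr (1 + q)"
    using M1 q0 by (intro powr_mono) auto
  then have "M \<le> Y" using MY M1 by simp
  \<comment> \<open>Rounding up adds at most 1, which is absorbed into a third \<open>Y\<close>
    because \<open>1 \<le> Y\<close>; this is where \<open>large\<close> and
    \<open>\<epsilon> \<le> 1\<close> enter.\<close>
  have r: "2 * Y \<le> real r" "real r \<le> 3 * Y"
    using Y1 unfolding r_def by linarith+
  then have r0: "0 < real r" using Y1 by linarith
  have Ypow: "Y ^ (2 * k) = M ^ (2 * k + 1) / \<epsilon>"
  proof -
    have e: "(1 + q) * real (2 * k) = real (2 * k + 1)"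
      using qk by (simp add: distrib_right)
    have "(M powr (1 + q)) ^ (2 * k) = M powr ((1 + q) * real (2 * k))"
      using M1 by (simp add: powr_powr flip: powr_realpow)
    then have "(M powr (1 + q)) ^ (2 * k) = M powr real (2 * k + 1)"
      by (simp only: e)
    moreover have "(\<epsilon> powr q) ^ (2 * k) = \<epsilon>"
      using eps qk by (simp add: powr_powr flip: powr_realpow)
    ultimately show ?thesis
      using M1 by (simp only: Y_def power_divide powr_realpow)
  qed
  define x where "x = 5 ^ (k - 1) * z / real r"
  have x: "x = M / (2 * real r)" by (simp add: x_def M_def B_def)
  have "0 \<le> x" "x \<le> 1"
    using M1 r r0 \<open>M \<le> Y\<close> by (auto simp: x field_simps)
  then have "exp x \<le> 3"
    using exp_le order_trans[of "exp x" "exp 1" 3] by simp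
  then have "real r * (2 * x ^ (2 * k + 1) * exp x) \<le> real r * (2 * x ^ (2 * k + 1) * 3)"
    using \<open>0 \<le> x\<close> r0 by (intro mult_left_mono) auto
  also have "\<dots> = 3 * M ^ (2 * k + 1) / (2 * real r) ^ (2 * k)"
    using r0 by (simp add: x power_divide field_simps)
  also have "\<dots> \<le> 3 * M ^ (2 * k + 1) / (4 * Y) ^ (2 * k)"
    using r Y1 M1 by (intro divide_left_mono power_mono mult_pos_pos zero_less_power) auto
  also have "\<dots> = 3 * \<epsilon> / 4 ^ (2 * k)"
    using M1 eps by (simp add: power_mult_distrib Ypow)
  also have "\<dots> \<le> \<epsilon>"
  proof -
    have "(4 :: real) ^ 1 \<le> 4 ^ (2 * k)"
      using k by (intro power_increasing) auto
    then show ?thesis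
      using eps by (simp add: divide_le_eq)
  qed
  finally have error: "real r * (2 * x ^ (2 * k + 1) * exp x) \<le> \<epsilon>" .
  \<comment> \<open>Since \<open>B \<le> 5 ^ k \<le> 4 ^ (2 * k)\<close>, the root
    \<open>B powr q\<close> is at most 4.\<close>
  have "B powr (1 + q) \<le> B * 4"
  proof -
    have "B \<le> 5 ^ k"
      using k by (cases k) (auto simp: B_def)
    also have "\<dots> \<le> (4\<^sup>2) ^ k"
      by (intro power_mono) auto
    finally have "B \<le> 4 powr (real (2 * k))"
      by (simp only: powr_realpow power_mult zero_less_numeral)
    then have "B powr q \<le> (4 powr real (2 * k)) powr q"
      using B1 q0 by (intro powr_mono2) auto
    also have "\<dots> = 4"
      using qk by (simp add: powr_powr mult.commute)
    finally show ?thesis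
      using B1 by (simp add: powr_add)
  qed
  \<comment> \<open>The constants just fit: the left side is \<open>24 * 5 ^ (k - 1)\<close>, the
    right side \<open>25 * 5 ^ (k - 1)\<close>.\<close>
  moreover have "3 * (B * 4) \<le> 5 ^ (k + 1)"
    using k by (cases k) (auto simp: B_def)
  ultimately have "3 * B powr (1 + q) \<le> 5 ^ (k + 1)"
    by linarith
  then have "3 * (B powr (1 + q) * z powr (1 + q)) / \<epsilon> powr q
      \<le> 5 ^ (k + 1) * z powr (1 + q) / \<epsilon> powr q"
    unfolding mult.assoc[symmetric] by (intro divide_right_mono mult_right_mono) auto
  also have "3 * (B powr (1 + q) * z powr (1 + q)) / \<epsilon> powr q = 3 * Y"
    using z0 B1 by (simp add: Y_def M_def powr_mult)
  finally have "real r \<le> 5 ^ (k + 1) * z powr (1 + q) / \<epsilon> powr q"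
    using r by linarith
  then show thesis
    using that[of r] error r0 unfolding x_def q_def by simp
qed

section \<open>Simulation of the Hamiltonian evolution\<close>

lemma hermitian_sum: "(\<And>j. j \<in> J \<Longrightarrow> hermitian (f j)) \<Longrightarrow> hermitian (\<Sum>j\<in>J. f j)"
  by (simp add: hermitian_def adj_def vec_eq_iff)

lemma endo_of_exp_product:
  "endo_of (exp_product Hs xs) = exp_list (\<lambda>j. endo_of (map_matrix (\<lambda>z. - \<i> * z) (Hs j))) xs"
  by (induction xs) (auto simp: exp_product_def endo_of_one endo_of_mult endo_of_evol)

lemma norm_exp_product:
  assumes "\<And>j. j \<in> fst ` set xs \<Longrightarrow> hermitian (Hs j)"
  shows "norm (exp_product Hs xs *v x) = norm x"
  using assms
  by (induction xs) (auto simp: exp_product_def norm_evol simp flip: matrix_vector_mul_assoc)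

lemma norm_exp_generator_le_1:
  assumes "hermitian H"
  shows "norm (exp (t *\<^sub>R endo_of (map_matrix (\<lambda>z. - \<i> * z) H))) \<le> 1"
  unfolding endo_of_evol[symmetric]
  by (rule norm_endo_le) (simp_all add: norm_evol[OF assms])

theorem theorem1:
  fixes H :: "complex^'n^'n" and Hs :: "nat \<Rightarrow> complex^'n^'n"
    and m k :: nat and t \<tau> \<epsilon> :: real
  assumes H: "H = (\<Sum>j=1..m. Hs j)"
    and hermitian: "\<And>j. j \<in> {1..m} \<Longrightarrow> hermitian (Hs j)"
    and norm_le: "\<And>j. j \<in> {1..m} \<Longrightarrow> op_norm (Hs j) \<le> op_norm H"
    and tau: "\<tau> = op_norm H * t"
    and k: "1 \<le> k"
    and eps: "0 < \<epsilon>" "\<epsilon> \<le> 1"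
    and large: "1 \<le> 2 * real m * 5 ^ (k - 1) * \<tau>"
  shows "\<exists>xs :: (nat \<times> real) list.
           fst ` set xs \<subseteq> {1..m} \<and>
           sim_error (exp_product Hs xs) (evol H t) \<le> \<epsilon> \<and>
           real (length xs) \<le>
             2 * real m * 5 ^ (2 * k) * (real m * \<tau>) powr (1 + 1 / (2 * real k))
               / \<epsilon> powr (1 / (2 * real k))"
proof -
  define a where "a = (\<lambda>j. endo_of (map_matrix (\<lambda>z. - \<i> * z) (Hs j)))"
  have sum_a: "(\<Sum>j=1..m. a j) = endo_of (map_matrix (\<lambda>z. - \<i> * z) H)"
  proof -
    have "map_matrix (\<lambda>z. - \<i> * z) H = (\<Sum>j=1..m. map_matrix (\<lambda>z. - \<i> * z) (Hs j))"
      by (simp add: H map_matrix_def vec_eq_iff sum_distrib_left sum_negf)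
    then show ?thesis
      by (simp add: a_def linear_sum[OF linear_endo_of])
  qed
  have herm: "hermitian H"
    unfolding H by (rule hermitian_sum) (rule hermitian)
  have norm0: "0 \<le> op_norm H"
    using norm_ge_zero[of "endo_of H"] by (simp only: norm_endo_of)
  \<comment> \<open>The sign of \<open>t\<close> follows from \<open>large\<close>, which forces
    \<open>\<tau>\<close> to be positive.\<close>
  have t0: "0 \<le> t"
  proof (rule ccontr)
    assume "\<not> 0 \<le> t"
    then have "\<tau> \<le> 0"
      using norm0 by (simp add: tau mult_nonneg_nonpos)
    then have "2 * real m * 5 ^ (k - 1) * \<tau> \<le> 0"
      by (intro mult_nonneg_nonpos) auto
    then show False using large by linarith
  qed
  obtain r where r: "0 < r"
    "real r * (2 * (5 ^ (k - 1) * (real m * \<tau>) / real r) ^ (2 * k + 1) *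
      exp (5 ^ (k - 1) * (real m * \<tau>) / real r)) \<le> \<epsilon>"
    "real r \<le> 5 ^ (k + 1) * (real m * \<tau>) powr (1 + 1 / (2 * real k)) / \<epsilon> powr (1 / (2 * real k))"
    by (rule suzuki_step_count[of k \<epsilon> "real m * \<tau>"]) (use k eps large in \<open>auto simp: mult_ac\<close>)
  \<comment> \<open>The hypothesis \<open>norm_le\<close> allows \<open>L\<close> to be the norm of
    \<open>H\<close>, so that \<open>L * t\<close> is exactly \<open>\<tau>\<close>.\<close>
  have bound: "norm (a j) \<le> op_norm H" if "j \<in> {1..m}" for j
    using norm_le[OF that] by (simp only: a_def norm_endo_of_generator)
  have contr: "norm (exp (s *\<^sub>R a j)) \<le> 1" if "j \<in> {1..m}" for j s
    unfolding a_def by (rule norm_exp_generator_le_1) (rule hermitian[OF that])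
  have contr_sum: "norm (exp (s *\<^sub>R (\<Sum>j=1..m. a j))) \<le> 1" for s
    unfolding sum_a by (rule norm_exp_generator_le_1[OF herm])
  obtain xs where xs: "fst ` set xs \<subseteq> {1..m}" "length xs = 2 * m * 5 ^ (k - 1) * r"
    "norm (exp_list a xs - exp (t *\<^sub>R (\<Sum>j=1..m. a j))) \<le>
      real r * (2 * (real m * 5 ^ (k - 1) * (op_norm H * t) / real r) ^ (2 * (k - 1) + 3) *
        exp (real m * 5 ^ (k - 1) * (op_norm H * t) / real r))"
    using suzuki_simulation[of m a "op_norm H" t r "k - 1", OF bound contr contr_sum norm0 t0 r(1)]
    by blast
  \<comment> \<open>The recursion runs \<open>k - 1\<close> times, giving order
    \<open>2 * k + 1\<close>. Each slice contributes \<open>5 ^ (k - 1)\<close> and the number of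
    slices \<open>5 ^ (k + 1)\<close>, together \<open>5 ^ (2 * k)\<close>.\<close>
  have exponent: "2 * (k - 1) + 3 = 2 * k + 1" and double: "2 * k = (k - 1) + (k + 1)"
    using k by simp_all
  have power: "(5 :: real) ^ (2 * k) = 5 ^ (k - 1) * 5 ^ (k + 1)"
    unfolding double by (rule power_add)
  have "op_norm (exp_product Hs xs - evol H t) = norm (exp_list a xs - exp (t *\<^sub>R (\<Sum>j=1..m. a j)))"
    unfolding norm_endo_of[symmetric] linear_diff[OF linear_endo_of] endo_of_exp_product
      endo_of_evol sum_a by (simp only: a_def)
  also have "\<dots> \<le> \<epsilon>"
    using xs(3) r(2) unfolding exponent by (simp add: tau mult_ac)
  finally have "sim_error (exp_product Hs xs) (evol H t) \<le> \<epsilon>"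
    using hermitian xs(1) by (intro sim_error_le norm_exp_product norm_evol[OF herm]) auto
  moreover have "real (length xs) \<le> 2 * real m * 5 ^ (2 * k) *
      (real m * \<tau>) powr (1 + 1 / (2 * real k)) / \<epsilon> powr (1 / (2 * real k))"
  proof -
    have "real (length xs) = 2 * real m * 5 ^ (k - 1) * real r"
      by (simp add: xs(2))
    also have "\<dots> \<le> 2 * real m * 5 ^ (k - 1) *
        (5 ^ (k + 1) * (real m * \<tau>) powr (1 + 1 / (2 * real k)) / \<epsilon> powr (1 / (2 * real k)))"
      using r(3) by (intro mult_left_mono) auto
    finally show ?thesis
      unfolding power by (simp only: mult.assoc times_divide_eq_right)
  qed
  ultimately show ?thesis
    using xs(1) by blast
qed

end
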